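(* Let $K\ge 1$ be an integer, let $0<r<1$, and let $G\in H^2(\mathbb{D})$ have a boundary function on $\partial\mathbb{D}$ whose values $G\left(e^{i\frac{2\pi m}{2^K}}\right)\in\mathbb{C}$, $m=0,1,\ldots,2^K-1$, are given. Put $W_{2^K}=e^{-i\frac{2\pi}{2^K}}$ and $a_j=r e^{i\frac{2\pi}{2^K}j}=rW_{2^K}^{-j}$ for $j=0,1,\ldots,2^K-1$, and define $$\langle G,e_{a_j}\rangle^{\tilde{}}=\sum_{m=0}^{2^K-1}\frac{\sqrt{1-r^2}}{2^K}\,G\left(e^{i\frac{2\pi m}{2^K}}\right)\frac{1}{1-a_j e^{-i\frac{2\pi m}{2^K}}},\qquad j=0,1,\ldots,2^K-1.$$ Let $c_0,\ldots,c_{2^K-1}$ be given, for $l=0,1,\ldots,2^{K-1}-1$, by $$c_l=\sum_{m=0}^{2^{K-1}-1}G\left(W_{2^K}^{-2m}\right)W_{2^K}^{2ml}+\sum_{m=0}^{2^{K-1}-1}G\left(W_{2^K}^{-(2m+1)}\right)W_{2^K}^{2ml}W_{2^K}^{l},$$ $$c_{l+2^{K-1}}=\sum_{m=0}^{2^{K-1}-1}G\left(W_{2^K}^{-2m}\right)W_{2^K}^{2ml}-\sum_{m=0}^{2^{K-1}-1}G\left(W_{2^K}^{-(2m+1)}\right)W_{2^K}^{2ml}W_{2^K}^{l}.$$ Then for every $j=0,1,\ldots,2^{K-1}-1$, $$\langle G,e_{a_j}\rangle^{\tilde{}}=\frac{\sqrt{1-r^2}}{2^K\left(1-r^{2^K}\right)}\left(\sum_{l=0}^{2^{K-1}-1}r^{2l}c_{2l}W_{2^K}^{-2jl}+\sum_{l=0}^{2^{K-1}-1}r^{2l+1}c_{2l+1}W_{2^K}^{-2jl}W_{2^K}^{-j}\right),$$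 $$\langle G,e_{a_{j+2^{K-1}}}\rangle^{\tilde{}}=\frac{\sqrt{1-r^2}}{2^K\left(1-r^{2^K}\right)}\left(\sum_{l=0}^{2^{K-1}-1}r^{2l}c_{2l}W_{2^K}^{-2jl}-\sum_{l=0}^{2^{K-1}-1}r^{2l+1}c_{2l+1}W_{2^K}^{-2jl}W_{2^K}^{-j}\right).$$
   Context: $\mathbb{D}=\{z\in\mathbb{C}:|z|<1\}$ and $H^2(\mathbb{D})$ is the Hardy space on the unit disc; $G$ on $\partial\mathbb{D}$ denotes its boundary function, and only its values at the $2^K$-th roots of unity are used. The quantity $\langle G,e_{a}\rangle^{\tilde{}}$ is just the finite sum defined in the claim; it is the equispaced discretization of the integral $\langle G,e_a\rangle=\frac{1}{2\pi}\int_0^{2\pi}G(e^{it})\frac{\sqrt{1-|a|^2}}{1-ae^{-it}}\,dt$, where $e_a(z)=\frac{\sqrt{1-|a|^2}}{1-\overline{a}z}$ for $a\in\mathbb{D}$. *)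

theory Defs
  imports "HOL-Analysis.Analysis"
begin

definition hardy_H2 :: "(complex \<Rightarrow> complex) set" where
  "hardy_H2 = {F. F holomorphic_on ball 0 1 \<and>
     bdd_above ((\<lambda>\<rho>. 1 / (2 * pi) *
        integral {0..2 * pi} (\<lambda>t. (cmod (F (of_real \<rho> * cis t)))\<^sup>2)) ` {0..<1::real})}"

text \<open>
  A boundary function is determined by \<^term>\<open>F\<close> only up to a null set of the circle; any
  representative is allowed here, in particular one with prescribed values at finitely many points.
  Only radial limits are required. For members of \<^const>\<open>hardy_H2\<close> this is
  equivalent, by Fatou's theorem, to having nontangential limits almost everywhere.
\<close>
definition boundary_function :: "(complex \<Rightarrow> complex) \<Rightarrow> (complex \<Rightarrow> complex) \<Rightarrow> bool" where
  "boundary_function F G \<longleftrightarrow>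
     (AE t in lborel. ((\<lambda>\<rho>::real. F (of_real \<rho> * cis t)) \<longlongrightarrow> G (cis t)) (at_left 1))"

definition W :: "nat \<Rightarrow> complex" where
  "W N = exp (- \<i> * of_real (2 * pi / real N))"

definition node :: "nat \<Rightarrow> real \<Rightarrow> nat \<Rightarrow> complex" where
  "node K r j = of_real r * exp (\<i> * of_real (2 * pi / 2 ^ K * real j))"

lemma node_eq_W: "node K r j = of_real r * W (2 ^ K) powi (- int j)"
  by (simp add: node_def W_def power_int_minus exp_of_nat_mult [symmetric] exp_minus [symmetric]
      mult_ac)

text \<open>
  The equispaced discretization, for the node \<open>a = node K r j\<close> with \<open>\<bar>a\<bar> = r\<close>, of the inner product
  of the boundary function \<^term>\<open>G\<close> with the normalized Szego kernel \<open>e\<^sub>a\<close>.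
\<close>
definition disc_inner :: "nat \<Rightarrow> real \<Rightarrow> (complex \<Rightarrow> complex) \<Rightarrow> nat \<Rightarrow> complex" where
  "disc_inner K r G j =
     (\<Sum>m = 0..<2 ^ K. of_real (sqrt (1 - r\<^sup>2) / 2 ^ K)
        * G (exp (\<i> * of_real (2 * pi * real m / 2 ^ K)))
        * (1 / (1 - node K r j * exp (- \<i> * of_real (2 * pi * real m / 2 ^ K)))))"

end

theory Submission imports Defs begin

text \<open>
  Write \<open>N = 2 ^ K\<close> and \<open>w = W N\<close>, so that \<open>w ^ N = 1\<close> and \<open>w ^ (N div 2) = - 1\<close>.
  The two formulas for \<open>c\<close> are one decimation-in-time step of the fast Fourier transform: splitting
  the sum over \<open>m\<close> by parity shows that \<open>c l = (\<Sum>m<N. G (w powi - m) * w ^ (m * l))\<close> for all \<open>l < N\<close>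
  (lemma \<open>dft_even_odd\<close>). On the other hand \<open>z = a\<^sub>j * w ^ m\<close> satisfies \<open>z ^ N = r ^ N\<close> and
  \<open>norm z < 1\<close>, so the kernel value \<open>1 / (1 - z)\<close> is the finite geometric sum
  \<open>(\<Sum>l<N. z ^ l) / (1 - r ^ N)\<close>. Interchanging the sums over \<open>m\<close> and \<open>l\<close> turns the discretized inner
  product into the inverse transform of \<open>r ^ l * c l\<close> (lemma \<open>kernel_sum_eq_dft\<close>, specialised in
  \<open>disc_inner_eq_dft\<close>). Splitting this sum by the parity of \<open>l\<close> gives the two claimed formulas,
  the sign for the index \<open>j + N div 2\<close> coming from \<open>w ^ (N div 2) = - 1\<close>.
\<close>

lemma sum_lessThan_double:
  fixes f :: "nat \<Rightarrow> 'a::comm_monoid_add"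
  shows "(\<Sum>i<2 * n. f i) = (\<Sum>i<n. f (2 * i)) + (\<Sum>i<n. f (2 * i + 1))"
  by (induction n) (simp_all add: algebra_simps)

lemma powi_minus_eq_inverse_power:
  fixes w :: "'a::division_ring"
  assumes "k = int n"
  shows "w powi (- k) = inverse w ^ n"
  using assms by (simp add: power_int_minus power_inverse)

text \<open>
  The hypotheses are the butterfly formulas: both halves of \<open>c\<close> are built from the transforms of the
  even-indexed and of the odd-indexed entries of \<open>g\<close>. These transforms have period \<open>h\<close> in \<open>l\<close>,
  whereas \<open>w ^ l\<close> changes sign when \<open>l\<close> increases by \<open>h\<close>.
  Only \<open>w ^ h = - 1\<close> is needed, so \<open>w\<close> may lie in any commutative ring.
\<close>
lemma dft_even_odd:
  fixes w :: "'a::comm_ring_1"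
  assumes wh: "w ^ h = - 1"
    and lo: "\<And>l. l < h \<Longrightarrow> c l = (\<Sum>m<h. g (2 * m) * w ^ (2 * m * l))
                            + (\<Sum>m<h. g (2 * m + 1) * w ^ (2 * m * l) * w ^ l)"
    and hi: "\<And>l. l < h \<Longrightarrow> c (l + h) = (\<Sum>m<h. g (2 * m) * w ^ (2 * m * l))
                            - (\<Sum>m<h. g (2 * m + 1) * w ^ (2 * m * l) * w ^ l)"
    and l: "l < 2 * h"
  shows "c l = (\<Sum>m<2 * h. g m * w ^ (m * l))"
proof (cases "l < h")
  case True
  show ?thesis
    unfolding lo[OF True] sum_lessThan_double by (simp add: power_add algebra_simps)
next
  case False
  define k where "k = l - h"
  have k: "k < h" "l = k + h" using False l by (auto simp: k_def)
  have ev: "w ^ (2 * m * (k + h)) = w ^ (2 * m * k)" for m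
  proof -
    have "w ^ (2 * m * (k + h)) = w ^ (2 * m * k) * (w ^ h) ^ (2 * m)"
      by (simp add: power_add power_mult[symmetric] algebra_simps)
    then show ?thesis by (simp add: wh)
  qed
  have od: "w ^ ((2 * m + 1) * (k + h)) = - (w ^ (2 * m * k) * w ^ k)" for m
  proof -
    have "w ^ ((2 * m + 1) * (k + h)) = w ^ (2 * m * (k + h)) * (w ^ k * w ^ h)"
      by (simp only: power_add[symmetric]) (simp add: algebra_simps)
    then show ?thesis by (simp only: ev wh) simp
  qed
  show ?thesis
    unfolding k(2) hi[OF k(1)] sum_lessThan_double ev od
    by (simp add: sum_negf mult.assoc)
qed

lemma kernel_sum_eq_dft:
  fixes w a :: complex and g c :: "nat \<Rightarrow> complex"
  assumes w: "norm w = 1" "w ^ N = 1" and a: "norm a < 1" and N: "0 < N"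
    and c: "\<And>l. l < N \<Longrightarrow> c l = (\<Sum>m<N. g m * w ^ (m * l))"
  shows "(\<Sum>m<N. g m * (1 / (1 - a * w ^ m))) = (\<Sum>l<N. a ^ l * c l) / (1 - a ^ N)"
proof -
  \<comment> \<open>The numerator \<open>1 - (a * w ^ m) ^ N\<close> of the geometric sum is \<open>1 - a ^ N\<close>, independent of \<open>m\<close>.\<close>
  have kernel: "1 / (1 - a * w ^ m) = (\<Sum>l<N. (a * w ^ m) ^ l) / (1 - a ^ N)" for m
  proof -
    have "norm (a * w ^ m) < 1" using a w by (simp add: norm_mult norm_power)
    then have ne: "a * w ^ m \<noteq> 1" by auto
    have "(w ^ m) ^ N = (w ^ N) ^ m" by (simp only: power_mult[symmetric] mult.commute)
    then have "(a * w ^ m) ^ N = a ^ N" using w by (simp add: power_mult_distrib)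
    then have "(1 - a * w ^ m) * (\<Sum>l<N. (a * w ^ m) ^ l) = 1 - a ^ N"
      using one_diff_power_eq[of "a * w ^ m" N] by simp
    moreover have "norm (a ^ N) < 1"
      using a N by (simp add: norm_power power_less_one_iff)
    then have "a ^ N \<noteq> 1" by auto
    ultimately show ?thesis using ne by (simp add: field_simps)
  qed
  have "(\<Sum>m<N. g m * (1 / (1 - a * w ^ m)))
      = (\<Sum>m<N. \<Sum>l<N. a ^ l * (g m * w ^ (m * l))) / (1 - a ^ N)"
    unfolding kernel sum_divide_distrib sum_distrib_left
    by (intro sum.cong refl) (simp add: power_mult_distrib power_mult)
  also have "(\<Sum>m<N. \<Sum>l<N. a ^ l * (g m * w ^ (m * l)))
      = (\<Sum>l<N. a ^ l * (\<Sum>m<N. g m * w ^ (m * l)))"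
    by (subst sum.swap) (simp add: sum_distrib_left)
  also have "\<dots> = (\<Sum>l<N. a ^ l * c l)"
    by (intro sum.cong) (simp_all add: c)
  finally show ?thesis .
qed

lemma W_power: "W N ^ n = exp (- \<i> * of_real (2 * pi * real n / real N))"
  by (simp add: W_def exp_of_nat_mult[symmetric] mult_ac)

lemma inverse_W_power: "inverse (W N) ^ n = exp (\<i> * of_real (2 * pi * real n / real N))"
  unfolding power_inverse W_power exp_minus[symmetric] by simp

lemma norm_W [simp]: "norm (W N) = 1"
  by (simp add: W_def norm_exp_eq_Re)

lemma W_power_self:
  assumes "0 < N"
  shows "W N ^ N = 1"
  using assms by (simp add: W_power exp_minus exp_two_pi_i' mult_ac)

lemma W_power_half:
  assumes "0 < n"
  shows "W (2 * n) ^ n = - 1"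
  using assms by (simp add: W_power exp_minus mult_ac)

lemma node_eq_inverse_W: "node K r j = of_real r * inverse (W (2 ^ K)) ^ j"
  by (simp add: node_eq_W powi_minus_eq_inverse_power[OF refl])

lemma disc_inner_eq_dft:
  assumes r: "0 < r" "r < 1"
    and c: "\<And>l. l < 2 ^ K \<Longrightarrow>
              c l = (\<Sum>m<2 ^ K. G (inverse (W (2 ^ K)) ^ m) * W (2 ^ K) ^ (m * l))"
  shows "disc_inner K r G j = of_real (sqrt (1 - r\<^sup>2) / (2 ^ K * (1 - r ^ (2 ^ K))))
           * (\<Sum>l<2 ^ K. of_real (r ^ l) * c l * inverse (W (2 ^ K)) ^ (j * l))"
proof -
  define N :: nat and w where "N = 2 ^ K" and "w = W N"
  define a where "a = of_real r * inverse w ^ j"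
  have wN: "w ^ N = 1" by (simp add: w_def N_def W_power_self)
  have "norm a = r" using r by (simp add: a_def w_def norm_mult norm_power norm_inverse)
  then have a1: "norm a < 1" using r by simp
  have "(inverse w ^ j) ^ N = inverse ((w ^ N) ^ j)"
    by (simp add: power_inverse power_mult[symmetric] mult.commute)
  then have aN: "a ^ N = of_real (r ^ N)" by (simp add: a_def power_mult_distrib wN)
  have "disc_inner K r G j
      = of_real (sqrt (1 - r\<^sup>2) / 2 ^ K) * (\<Sum>m<N. G (inverse w ^ m) * (1 / (1 - a * w ^ m)))"
    unfolding disc_inner_def sum_distrib_left node_eq_inverse_W
    by (intro sum.cong)
       (simp_all add: a_def w_def N_def inverse_W_power W_power atLeast0LessThan mult.assoc)
  also have "(\<Sum>m<N. G (inverse w ^ m) * (1 / (1 - a * w ^ m)))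
      = (\<Sum>l<N. a ^ l * c l) / (1 - a ^ N)"
    by (rule kernel_sum_eq_dft) (use wN a1 c in \<open>auto simp: w_def N_def\<close>)
  also have "(\<Sum>l<N. a ^ l * c l) = (\<Sum>l<N. of_real (r ^ l) * c l * inverse w ^ (j * l))"
    by (intro sum.cong) (simp_all add: a_def power_mult_distrib power_mult[symmetric] mult_ac)
  finally show ?thesis unfolding aN by (simp add: N_def w_def)
qed

theorem theorem3p1:
  fixes K :: nat and r :: real and F G :: "complex \<Rightarrow> complex" and c :: "nat \<Rightarrow> complex"
  assumes "K \<ge> 1" and "0 < r" and "r < 1"
    and "F \<in> hardy_H2" and "boundary_function F G"
    and "\<And>l. l < 2 ^ (K - 1) \<Longrightarrow>
      c l = (\<Sum>m = 0..<2 ^ (K - 1). G (W (2 ^ K) powi (- (2 * int m))) * W (2 ^ K) ^ (2 * m * l))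
          + (\<Sum>m = 0..<2 ^ (K - 1). G (W (2 ^ K) powi (- (2 * int m + 1)))
                * W (2 ^ K) ^ (2 * m * l) * W (2 ^ K) ^ l)"
    and "\<And>l. l < 2 ^ (K - 1) \<Longrightarrow>
      c (l + 2 ^ (K - 1)) =
            (\<Sum>m = 0..<2 ^ (K - 1). G (W (2 ^ K) powi (- (2 * int m))) * W (2 ^ K) ^ (2 * m * l))
          - (\<Sum>m = 0..<2 ^ (K - 1). G (W (2 ^ K) powi (- (2 * int m + 1)))
                * W (2 ^ K) ^ (2 * m * l) * W (2 ^ K) ^ l)"
  shows "\<forall>j < 2 ^ (K - 1).
      disc_inner K r G j = of_real (sqrt (1 - r\<^sup>2) / (2 ^ K * (1 - r ^ (2 ^ K))))
        * ((\<Sum>l = 0..<2 ^ (K - 1). of_real (r ^ (2 * l)) * c (2 * l)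
               * W (2 ^ K) powi (- (2 * int j * int l)))
         + (\<Sum>l = 0..<2 ^ (K - 1). of_real (r ^ (2 * l + 1)) * c (2 * l + 1)
               * W (2 ^ K) powi (- (2 * int j * int l)) * W (2 ^ K) powi (- int j)))
    \<and> disc_inner K r G (j + 2 ^ (K - 1)) = of_real (sqrt (1 - r\<^sup>2) / (2 ^ K * (1 - r ^ (2 ^ K))))
        * ((\<Sum>l = 0..<2 ^ (K - 1). of_real (r ^ (2 * l)) * c (2 * l)
               * W (2 ^ K) powi (- (2 * int j * int l)))
         - (\<Sum>l = 0..<2 ^ (K - 1). of_real (r ^ (2 * l + 1)) * c (2 * l + 1)
               * W (2 ^ K) powi (- (2 * int j * int l)) * W (2 ^ K) powi (- int j)))"
proof -
  define h :: nat and w where "h = 2 ^ (K - 1)" and "w = W (2 ^ K)"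
  define v where "v = inverse w"
  have N: "2 ^ K = 2 * h" using assms(1) by (cases K) (auto simp: h_def)
  have wh: "w ^ h = - 1" unfolding w_def N by (rule W_power_half) (simp add: h_def)
  then have vh: "v ^ h = - 1" by (simp add: v_def power_inverse)
  have powi: "w powi (- (2 * int m)) = v ^ (2 * m)"
    "w powi (- (2 * int m + 1)) = v ^ (2 * m + 1)"
    "w powi (- (2 * int m * int l)) = v ^ (2 * m * l)"
    "w powi (- int m) = v ^ m" for m l
    unfolding v_def by (rule powi_minus_eq_inverse_power; simp)+
  note c = assms(6,7)[folded w_def h_def, unfolded powi atLeast0LessThan]
  have dft: "c l = (\<Sum>m<2 ^ K. G (inverse (W (2 ^ K)) ^ m) * W (2 ^ K) ^ (m * l))"
    if "l < 2 ^ K" for l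
    unfolding N w_def[unfolded N, symmetric] v_def[symmetric]
    by (rule dft_even_odd[OF wh]) (use c that in \<open>simp_all add: N\<close>)
  define C where "C = complex_of_real (sqrt (1 - r\<^sup>2) / (2 ^ K * (1 - r ^ (2 ^ K))))"
  have inner: "disc_inner K r G j
      = C * ((\<Sum>l<h. of_real (r ^ (2 * l)) * c (2 * l) * v ^ (j * (2 * l)))
           + (\<Sum>l<h. of_real (r ^ (2 * l + 1)) * c (2 * l + 1) * v ^ (j * (2 * l + 1))))" for j
    using disc_inner_eq_dft[OF assms(2,3) dft, of j, folded w_def v_def C_def]
    by (simp only: N sum_lessThan_double)
  have ev: "v ^ (j * (2 * l)) = v ^ (2 * j * l)"
    and od: "v ^ (j * (2 * l + 1)) = v ^ (2 * j * l) * v ^ j" for j l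
    by (simp_all only: power_add[symmetric]) (simp_all add: algebra_simps)
  \<comment> \<open>The even terms agree at \<open>j\<close> and \<open>j + h\<close>; the odd terms keep one factor \<open>v ^ h = - 1\<close>.\<close>
  have v2: "v ^ (2 * (j + h) * l) = v ^ (2 * j * l)" for j l
  proof -
    have "v ^ (2 * (j + h) * l) = v ^ (2 * j * l) * (v ^ h) ^ (2 * l)"
      by (simp only: power_mult[symmetric] power_add[symmetric]) (simp add: algebra_simps)
    then show ?thesis by (simp add: vh)
  qed
  show ?thesis
    unfolding w_def[symmetric] h_def[symmetric] C_def[symmetric] powi atLeast0LessThan
      inner ev od v2 power_add[of v _ h] vh
    by (simp add: sum_negf mult.assoc)
qed

end
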